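(* Let $Q\in\mathbb{R}^{n\times n}$ be symmetric, $c\in\mathbb{R}^n$, $A\in\mathbb{R}^{m\times n}$ and $b\in\mathbb{R}^m$. For the quadratic program $$\operatorname*{minimize}_{x\in\mathbb{R}^n}\ \tfrac12x^TQx+c^Tx\quad\text{subject to}\quad Ax\le b,$$ the set of its isolated (equivalently, strict, strong) local minimizers is finite.
   Context: Let $q$ be the objective and $P$ the feasible set, $\bar x\in P$. Then $\bar x$ is: a local minimizer if there is a neighborhood $\mathcal N$ of $\bar x$ with $q(x)\ge q(\bar x)$ for all $x\in P\cap\mathcal N$; a strict local minimizer if there is $\mathcal N$ with $q(x)>q(\bar x)$ for all $x\in P\cap\mathcal N$, $x\neq\bar x$; an isolated local minimizer if it is a local minimizer and there is $\mathcal N$ containing no other local minimizer of $q$ on $P$; a strong local minimizer if there are $c_0>0$ and $\mathcal N$ with $q(x)\ge q(\bar x)+c_0\|x-\bar x\|^2$ for all $x\in P\cap\mathcal N$. For quadratic programs the last three notions are known to be equivalent. *)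

theory Defs
  imports "HOL-Analysis.Analysis"
begin

text \<open>
  In the following definitions \<open>f\<close> is the objective and \<open>P\<close> the feasible set.
  A neighborhood of \<open>x\<close> is rendered as an open set containing \<open>x\<close>; every property below
  passes to smaller neighborhoods, so this is no restriction.
\<close>

definition local_minimizer :: "('a::real_normed_vector \<Rightarrow> real) \<Rightarrow> 'a set \<Rightarrow> 'a \<Rightarrow> bool" where
  "local_minimizer f P x \<longleftrightarrow>
     x \<in> P \<and> (\<exists>N. open N \<and> x \<in> N \<and> (\<forall>y \<in> P \<inter> N. f y \<ge> f x))"

definition strict_local_minimizer :: "('a::real_normed_vector \<Rightarrow> real) \<Rightarrow> 'a set \<Rightarrow> 'a \<Rightarrow> bool" where
  "strict_local_minimizer f P x \<longleftrightarrow>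
     x \<in> P \<and> (\<exists>N. open N \<and> x \<in> N \<and> (\<forall>y \<in> P \<inter> N. y \<noteq> x \<longrightarrow> f y > f x))"

definition isolated_local_minimizer :: "('a::real_normed_vector \<Rightarrow> real) \<Rightarrow> 'a set \<Rightarrow> 'a \<Rightarrow> bool" where
  "isolated_local_minimizer f P x \<longleftrightarrow>
     local_minimizer f P x \<and>
     (\<exists>N. open N \<and> x \<in> N \<and> (\<forall>y \<in> N. local_minimizer f P y \<longrightarrow> y = x))"

definition strong_local_minimizer :: "('a::real_normed_vector \<Rightarrow> real) \<Rightarrow> 'a set \<Rightarrow> 'a \<Rightarrow> bool" where
  "strong_local_minimizer f P x \<longleftrightarrow>
     x \<in> P \<and>
     (\<exists>c0 > 0. \<exists>N. open N \<and> x \<in> N \<and> (\<forall>y \<in> P \<inter> N. f y \<ge> f x + c0 * (norm (y - x))\<^sup>2))"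

definition qp_objective :: "real^'n^'n \<Rightarrow> real^'n \<Rightarrow> real^'n \<Rightarrow> real" where
  "qp_objective Q c x = 1/2 * (x \<bullet> (Q *v x)) + c \<bullet> x"

text \<open>The order on vectors is the componentwise one (\<open>less_eq_vec_def\<close>).\<close>

definition qp_feasible :: "real^'n^'m \<Rightarrow> real^'m \<Rightarrow> (real^'n) set" where
  "qp_feasible A b = {x. A *v x \<le> b}"

end

theory Submission
  imports Defs
begin

text \<open>
  Near a feasible point \<open>x\<close> the polyhedron coincides with \<open>x + K\<close>, where \<open>K\<close> is the cone cut out by
  the constraints active at \<open>x\<close>, and the objective is exactly quadratic there. If \<open>x\<close> is a strict
  minimizer, then on the unit vectors \<open>u\<close> of \<open>K\<close> the slope and the curvature of the objective are
  never both nonpositive; by compactness their maximum is bounded below by some \<open>\<mu> > 0\<close>, which gives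
  quadratic growth. A second local minimizer \<open>x + d\<close> close to \<open>x\<close> would have to satisfy
  \<open>\<nabla>q(x) \<bullet> d + d \<bullet> Q d \<le> 0\<close>, whereas \<open>q (x + 2 d) > q x\<close> says the opposite. Finally, two strict
  minimizers with the same active constraints can both be moved in the directions \<open>\<plusminus>(y - x)\<close>, which
  makes the objective a quadratic function on a line with two strict minimizers; so strict minimizers
  are determined by their active sets.
\<close>

section \<open>Local structure of the feasible set\<close>

definition active_set :: "real^'n^'m \<Rightarrow> real^'m \<Rightarrow> real^'n \<Rightarrow> 'm set" where
  "active_set A b x = {i. (A *v x) $ i = b $ i}"

definition feasible_cone :: "real^'n^'m \<Rightarrow> real^'m \<Rightarrow> real^'n \<Rightarrow> (real^'n) set" where
  "feasible_cone A b x = {d. \<forall>i \<in> active_set A b x. (A *v d) $ i \<le> 0}"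

lemma scaleR_mem_feasible_cone:
  assumes "d \<in> feasible_cone A b x" "0 \<le> t"
  shows "t *\<^sub>R d \<in> feasible_cone A b x"
  using assms
  by (auto simp: feasible_cone_def matrix_vector_mult_scaleR mult_nonneg_nonpos)

lemma closed_feasible_cone: "closed (feasible_cone A b x)"
proof -
  have "feasible_cone A b x = (\<Inter>i \<in> active_set A b x. {d. A $ i \<bullet> d \<le> 0})"
    by (auto simp: feasible_cone_def matrix_vector_mul_component)
  then show ?thesis
    by (auto intro!: closed_INT closed_Collect_le continuous_intros)
qed

text \<open>Inactive constraints have slack at \<open>x\<close>, which survives small moves, and
  finitely many of them admit a common radius. Active constraints hold with equality at
  \<open>x\<close>, so only the sign of \<open>(A *v d) $ i\<close> decides whether
  \<open>x + d\<close> satisfies them.\<close>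

lemma qp_feasible_locally_cone:
  fixes A :: "real^'n^'m"
  assumes "x \<in> qp_feasible A b"
  obtains r where "0 < r"
    "\<And>d. norm d < r \<Longrightarrow> x + d \<in> qp_feasible A b \<longleftrightarrow> d \<in> feasible_cone A b x"
proof -
  have le: "(A *v x) $ i \<le> b $ i" for i
    using assms by (simp add: qp_feasible_def less_eq_vec_def)
  have "\<forall>\<^sub>F d in nhds 0. i \<notin> active_set A b x \<longrightarrow> (A *v (x + d)) $ i < b $ i" for i
  proof (cases "i \<in> active_set A b x")
    case False
    then have "A $ i \<bullet> (x + 0) < b $ i"
      using le[of i] by (simp add: active_set_def matrix_vector_mul_component)
    moreover have "open {d. A $ i \<bullet> (x + d) < b $ i}"
      by (intro open_Collect_less continuous_intros)
    ultimately have "\<forall>\<^sub>F d in nhds 0. d \<in> {d. A $ i \<bullet> (x + d) < b $ i}"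
      by (intro eventually_nhds_in_open) auto
    then show ?thesis
      by eventually_elim (simp add: matrix_vector_mul_component)
  qed simp
  then have "\<forall>\<^sub>F d in nhds 0. \<forall>i. i \<notin> active_set A b x \<longrightarrow> (A *v (x + d)) $ i < b $ i"
    by (rule eventually_all_finite)
  then obtain r where r: "0 < r"
    "\<And>d i. norm d < r \<Longrightarrow> i \<notin> active_set A b x \<Longrightarrow> (A *v (x + d)) $ i < b $ i"
    unfolding eventually_nhds_metric dist_0_norm by (metis dist_norm diff_zero)
  show thesis
  proof
    show "0 < r" by fact
    fix d :: "real^'n"
    assume d: "norm d < r"
    have "(A *v (x + d)) $ i \<le> b $ i \<longleftrightarrow> (i \<in> active_set A b x \<longrightarrow> (A *v d) $ i \<le> 0)" for i
      using r(2)[OF d, of i]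
      by (cases "i \<in> active_set A b x")
        (auto simp: active_set_def matrix_vector_right_distrib)
    then show "x + d \<in> qp_feasible A b \<longleftrightarrow> d \<in> feasible_cone A b x"
      by (auto simp: qp_feasible_def feasible_cone_def less_eq_vec_def)
  qed
qed

section \<open>Slope and curvature along feasible directions\<close>

lemma qp_objective_add:
  assumes "transpose Q = Q"
  shows "qp_objective Q c (x + d) =
    qp_objective Q c x + (Q *v x + c) \<bullet> d + 1/2 * (d \<bullet> (Q *v d))"
proof -
  \<comment> \<open>Symmetry of \<open>Q\<close> merges the two cross terms of the expansion, so
    that the linear part is the gradient \<open>Q *v x + c\<close>.\<close>
  have "x \<bullet> (Q *v d) = (Q *v x) \<bullet> d"
    using assms by (metis dot_lmul_matrix transpose_matrix_vector)
  then show ?thesis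
    by (simp add: qp_objective_def matrix_vector_right_distrib inner_add_left inner_add_right
        inner_commute algebra_simps)
qed

lemma strict_local_minimizer_qpD:
  fixes Q :: "real^'n^'n"
  assumes "transpose Q = Q"
    and "strict_local_minimizer (qp_objective Q c) (qp_feasible A b) x"
  obtains r where "0 < r"
    "\<And>d. norm d < r \<Longrightarrow> x + d \<in> qp_feasible A b \<longleftrightarrow> d \<in> feasible_cone A b x"
    "\<And>d. norm d < r \<Longrightarrow> d \<in> feasible_cone A b x \<Longrightarrow> d \<noteq> 0 \<Longrightarrow>
       0 < (Q *v x + c) \<bullet> d + 1/2 * (d \<bullet> (Q *v d))"
proof -
  obtain N where x: "x \<in> qp_feasible A b" and N: "open N" "x \<in> N"
    "\<And>y. y \<in> qp_feasible A b \<Longrightarrow> y \<in> N \<Longrightarrow> y \<noteq> x \<Longrightarrow> qp_objective Q c x < qp_objective Q c y"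
    using assms(2) unfolding strict_local_minimizer_def by blast
  obtain s where s: "0 < s" "ball x s \<subseteq> N"
    using N(1,2) open_contains_ball by blast
  obtain r where r: "0 < r"
    "\<And>d. norm d < r \<Longrightarrow> x + d \<in> qp_feasible A b \<longleftrightarrow> d \<in> feasible_cone A b x"
    using qp_feasible_locally_cone[OF x] by blast
  show thesis
  proof
    show "0 < min r s" using r s by simp
    fix d :: "real^'n"
    assume d: "norm d < min r s"
    then show "x + d \<in> qp_feasible A b \<longleftrightarrow> d \<in> feasible_cone A b x"
      using r by simp
    assume "d \<in> feasible_cone A b x" "d \<noteq> 0"
    moreover have "x + d \<in> N"
      using d s by (auto simp: dist_norm)
    ultimately have "qp_objective Q c x < qp_objective Q c (x + d)"
      using N(3) r(2) d by simp
    then show "0 < (Q *v x + c) \<bullet> d + 1/2 * (d \<bullet> (Q *v d))"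
      by (simp add: qp_objective_add[OF assms(1)])
  qed
qed

text \<open>Dividing by \<open>t\<close> leaves an affine function that is positive on the interval
  from \<open>0\<close> to \<open>e\<close>. Its limit at \<open>0\<close> settles the sign of
  \<open>\<alpha>\<close>; if \<open>\<alpha>\<close> vanishes, a single value of \<open>t\<close>
  settles that of \<open>\<beta>\<close>.\<close>

lemma quadratic_pos_near_zero:
  fixes \<alpha> \<beta> :: real
  assumes "0 < e" and pos: "\<And>t. 0 < t \<Longrightarrow> t < e \<Longrightarrow> 0 < t * \<alpha> + t\<^sup>2 * \<beta>"
  shows "0 \<le> \<alpha>" and "\<alpha> = 0 \<Longrightarrow> 0 < \<beta>"
proof -
  have lin: "0 < \<alpha> + t * \<beta>" if "0 < t" "t < e" for t
  proof -
    have "t * \<alpha> + t\<^sup>2 * \<beta> = t * (\<alpha> + t * \<beta>)"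
      by (simp add: power2_eq_square algebra_simps)
    then show ?thesis
      using pos[OF that] that by (simp add: zero_less_mult_iff)
  qed
  have "((\<lambda>t. \<alpha> + t * \<beta>) \<longlongrightarrow> \<alpha> + 0 * \<beta>) (at_right 0)"
    by (intro tendsto_intros)
  moreover have "\<forall>\<^sub>F t in at_right 0. 0 \<le> \<alpha> + t * \<beta>"
    unfolding eventually_at_right[OF \<open>0 < e\<close>] using lin \<open>0 < e\<close>
    by (auto intro: less_imp_le)
  ultimately have "0 \<le> \<alpha> + 0 * \<beta>"
    by (rule tendsto_lowerbound) simp
  then show "0 \<le> \<alpha>" by simp
  show "0 < \<beta>" if "\<alpha> = 0"
    using lin[of "e / 2"] that \<open>0 < e\<close> by (simp add: zero_less_mult_iff)
qed

text \<open>Along the ray spanned by \<open>d\<close> the increment of the objective is a quadratic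
  polynomial in the step \<open>t\<close>, with the slope as linear and half the curvature as
  quadratic coefficient. Strictness makes it positive for small \<open>t > 0\<close>.\<close>

lemma strict_local_minimizer_qp_slope_curvature:
  assumes "transpose Q = Q"
    and "strict_local_minimizer (qp_objective Q c) (qp_feasible A b) x"
    and d: "d \<in> feasible_cone A b x" "d \<noteq> 0"
  shows "0 \<le> (Q *v x + c) \<bullet> d"
    and "(Q *v x + c) \<bullet> d = 0 \<Longrightarrow> 0 < d \<bullet> (Q *v d)"
proof -
  obtain r where r: "0 < r"
    "\<And>d. norm d < r \<Longrightarrow> d \<in> feasible_cone A b x \<Longrightarrow> d \<noteq> 0 \<Longrightarrow>
       0 < (Q *v x + c) \<bullet> d + 1/2 * (d \<bullet> (Q *v d))"
    using strict_local_minimizer_qpD[OF assms(1,2)] by metis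
  have e: "0 < r / norm d"
    using r d by simp
  have pos: "0 < t * ((Q *v x + c) \<bullet> d) + t\<^sup>2 * (1/2 * (d \<bullet> (Q *v d)))"
    if "0 < t" "t < r / norm d" for t
  proof -
    have "norm (t *\<^sub>R d) < r"
      using that d by (simp add: pos_less_divide_eq)
    then have "0 < (Q *v x + c) \<bullet> (t *\<^sub>R d) + 1/2 * ((t *\<^sub>R d) \<bullet> (Q *v (t *\<^sub>R d)))"
      using that d by (intro r(2) scaleR_mem_feasible_cone) auto
    then show ?thesis
      by (simp add: matrix_vector_mult_scaleR power2_eq_square algebra_simps)
  qed
  show "0 \<le> (Q *v x + c) \<bullet> d"
    by (rule quadratic_pos_near_zero(1)[OF e pos])
  show "0 < d \<bullet> (Q *v d)" if "(Q *v x + c) \<bullet> d = 0"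
    using quadratic_pos_near_zero(2)[OF e pos that] by simp
qed

section \<open>Equivalence of strict, strong and isolated minimizers\<close>

lemma strong_imp_strict_local_minimizer:
  assumes "strong_local_minimizer f P x"
  shows "strict_local_minimizer f P x"
proof -
  obtain c0 N where x: "x \<in> P" "0 < c0" "open N" "x \<in> N"
    and ge: "\<And>y. y \<in> P \<Longrightarrow> y \<in> N \<Longrightarrow> f x + c0 * (norm (y - x))\<^sup>2 \<le> f y"
    using assms unfolding strong_local_minimizer_def by blast
  have "f x < f y" if "y \<in> P" "y \<in> N" "y \<noteq> x" for y
  proof -
    have "0 < c0 * (norm (y - x))\<^sup>2"
      using that x by simp
    then show ?thesis
      using ge[of y] that by linarith
  qed
  then show ?thesis
    unfolding strict_local_minimizer_def using x by blast
qed

text \<open>A feasible point near \<open>x\<close> with the same value would be a local minimizer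
  too, because the open set \<open>N\<close> is also a neighborhood of that point. Isolation
  excludes this.\<close>

lemma isolated_imp_strict_local_minimizer:
  assumes "isolated_local_minimizer f P x"
  shows "strict_local_minimizer f P x"
proof -
  obtain N where x: "x \<in> P" and N: "open N" "x \<in> N" "\<And>y. y \<in> P \<Longrightarrow> y \<in> N \<Longrightarrow> f x \<le> f y"
    using assms unfolding isolated_local_minimizer_def local_minimizer_def by blast
  obtain M where M: "open M" "x \<in> M" "\<And>y. y \<in> M \<Longrightarrow> local_minimizer f P y \<Longrightarrow> y = x"
    using assms unfolding isolated_local_minimizer_def by blast
  have "f x < f y" if y: "y \<in> P" "y \<in> N" "y \<in> M" "y \<noteq> x" for y
  proof (rule ccontr)
    assume "\<not> f x < f y"
    then have "f y = f x"
      using N(3) y by fastforce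
    then have "local_minimizer f P y"
      unfolding local_minimizer_def using N y by auto
    then show False
      using M(3) y by blast
  qed
  then show ?thesis
    unfolding strict_local_minimizer_def using x N(1,2) M(1,2)
    by (metis IntD1 IntD2 IntI open_Int)
qed

lemma strict_imp_strong_local_minimizer_qp:
  assumes "transpose Q = Q"
    and strict: "strict_local_minimizer (qp_objective Q c) (qp_feasible A b) x"
  shows "strong_local_minimizer (qp_objective Q c) (qp_feasible A b) x"
proof -
  define g where "g = Q *v x + c"
  define S where "S = feasible_cone A b x \<inter> sphere 0 1"
  have cont: "continuous_on S (\<lambda>u. max (g \<bullet> u) (u \<bullet> (Q *v u)))"
    by (intro continuous_intros linear_continuous_on_compose[OF continuous_on_id] matrix_vector_mul_linear)
  have "compact S"
    unfolding S_def by (intro closed_Int_compact closed_feasible_cone compact_sphere)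
  have posS: "0 < max (g \<bullet> u) (u \<bullet> (Q *v u))" if "u \<in> S" for u
  proof -
    have "u \<in> feasible_cone A b x" "u \<noteq> 0"
      using that by (auto simp: S_def)
    then show ?thesis
      using strict_local_minimizer_qp_slope_curvature[OF assms, of u]
      by (fastforce simp: g_def less_max_iff_disj)
  qed
  \<comment> \<open>If the cone contains no unit vector, there is nothing to bound and
    \<open>1\<close> serves as default. Otherwise the minimum over the compact set \<open>S\<close>
    is attained and hence positive.\<close>
  obtain \<mu> where \<mu>: "0 < \<mu>" "\<And>u. u \<in> S \<Longrightarrow> \<mu> \<le> max (g \<bullet> u) (u \<bullet> (Q *v u))"
  proof (cases "S = {}")
    case True
    then show thesis using that[of 1] by simp
  next
    case False
    then show thesis
      using continuous_attains_inf[OF \<open>compact S\<close> False cont] posS that by metis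
  qed
  obtain B where B: "0 < B" "\<And>u. norm (Q *v u) \<le> norm u * B"
    using linear_bounded_pos[OF matrix_vector_mul_linear[of Q]] by (metis mult.commute)
  obtain r where r: "0 < r"
    "\<And>d. norm d < r \<Longrightarrow> x + d \<in> qp_feasible A b \<longleftrightarrow> d \<in> feasible_cone A b x"
    using strict_local_minimizer_qpD[OF assms] by metis
  \<comment> \<open>Radius \<open>r\<close> keeps feasibility equivalent to membership in the cone;
    the bounds \<open>1\<close> and \<open>\<mu> / B\<close> give
    \<open>t * \<mu> \<le> \<mu>\<close> and \<open>t * B \<le> \<mu>\<close> for the case of large
    slope.\<close>
  define e where "e = min r (min 1 (\<mu> / B))"
  have growth: "\<mu> / 2 * t\<^sup>2 \<le> t * (g \<bullet> u) + t\<^sup>2 / 2 * (u \<bullet> (Q *v u))"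
    if u: "u \<in> S" and t: "0 < t" "t < e" for u t
  proof -
    have nu: "u \<in> feasible_cone A b x" "norm u = 1" "u \<noteq> 0"
      using u by (auto simp: S_def)
    have "0 \<le> g \<bullet> u"
      using strict_local_minimizer_qp_slope_curvature(1)[OF assms nu(1,3)] by (simp add: g_def)
    consider "\<mu> \<le> u \<bullet> (Q *v u)" | "\<mu> \<le> g \<bullet> u"
      using \<mu>(2)[OF u] by linarith
    then show ?thesis
    proof cases
      case 1
      then have "t\<^sup>2 / 2 * \<mu> \<le> t\<^sup>2 / 2 * (u \<bullet> (Q *v u))"
        by (intro mult_left_mono) auto
      moreover have "0 \<le> t * (g \<bullet> u)"
        using \<open>0 \<le> g \<bullet> u\<close> t by simp
      ultimately show ?thesis by (simp add: mult.commute)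
    next
      case 2
      \<comment> \<open>The curvature may be negative here, but it costs at most
        \<open>t * B / 2\<close>, which half of the slope bound \<open>\<mu>\<close> absorbs; the
        other half dominates \<open>\<mu> / 2 * t\<close>.\<close>
      have "\<bar>u \<bullet> (Q *v u)\<bar> \<le> B"
        using Cauchy_Schwarz_ineq2[of u "Q *v u"] B(2)[of u] nu by simp
      moreover have "t * B \<le> \<mu>"
        using t B(1) by (simp add: e_def pos_less_divide_eq)
      moreover have "t * \<mu> \<le> \<mu>"
        using t \<mu>(1) by (simp add: e_def)
      moreover have "t * - B \<le> t * (u \<bullet> (Q *v u))"
        using calculation(1) t by (intro mult_left_mono) auto
      ultimately have "\<mu> / 2 * t \<le> g \<bullet> u + t / 2 * (u \<bullet> (Q *v u))"
        using 2 by (simp add: mult.commute)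
      then have "t * (\<mu> / 2 * t) \<le> t * (g \<bullet> u + t / 2 * (u \<bullet> (Q *v u)))"
        using t by (intro mult_left_mono) auto
      then show ?thesis
        by (simp add: power2_eq_square algebra_simps)
    qed
  qed
  have "qp_objective Q c x + \<mu> / 2 * (norm (y - x))\<^sup>2 \<le> qp_objective Q c y"
    if y: "y \<in> qp_feasible A b" "y \<in> ball x e" for y
  proof (cases "y = x")
    case False
    define d where "d = y - x"
    define t where "t = norm d"
    define u where "u = d /\<^sub>R t"
    have t: "0 < t" "t < e"
      using False y by (auto simp: t_def d_def dist_norm norm_minus_commute)
    have d: "d = t *\<^sub>R u"
      using t by (simp add: u_def)
    have "d \<in> feasible_cone A b x"
      using r(2)[of d] t y by (simp add: t_def d_def e_def)
    then have "u \<in> S"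
      using t by (auto simp: S_def u_def t_def intro!: scaleR_mem_feasible_cone)
    then have "\<mu> / 2 * t\<^sup>2 \<le> g \<bullet> d + 1/2 * (d \<bullet> (Q *v d))"
      using growth[OF _ t] unfolding d
      by (simp add: matrix_vector_mult_scaleR power2_eq_square mult.assoc)
    moreover have "qp_objective Q c y = qp_objective Q c x + g \<bullet> d + 1/2 * (d \<bullet> (Q *v d))"
      using qp_objective_add[OF assms(1), of c x d] by (simp add: d_def g_def)
    ultimately show ?thesis
      by (simp add: t_def d_def)
  qed simp
  moreover have "0 < e"
    using r \<mu> B by (simp add: e_def)
  ultimately show ?thesis
    using strict \<mu>(1) unfolding strong_local_minimizer_def strict_local_minimizer_def
    by (intro conjI exI[of _ "\<mu> / 2"] exI[of _ "ball x e"]) auto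
qed

lemma convex_qp_feasible: "convex (qp_feasible A b)"
proof -
  have "qp_feasible A b = (\<Inter>i. {x. A $ i \<bullet> x \<le> b $ i})"
    by (auto simp: qp_feasible_def less_eq_vec_def matrix_vector_mul_component)
  then show ?thesis
    by (auto intro: convex_INT convex_halfspace_le)
qed

text \<open>By convexity the segment from \<open>y\<close> to \<open>x\<close> is feasible. The
  increment of the objective along it, divided by the step, is nonnegative for small steps and tends
  to the slope.\<close>

lemma local_minimizer_qp_slope:
  assumes "transpose Q = Q"
    and lm: "local_minimizer (qp_objective Q c) (qp_feasible A b) y"
    and x: "x \<in> qp_feasible A b"
  shows "0 \<le> (Q *v y + c) \<bullet> (x - y)"
proof -
  obtain N where y: "y \<in> qp_feasible A b" and N: "open N" "y \<in> N"
    "\<And>z. z \<in> qp_feasible A b \<Longrightarrow> z \<in> N \<Longrightarrow> qp_objective Q c y \<le> qp_objective Q c z"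
    using lm unfolding local_minimizer_def by blast
  define d where "d = x - y"
  have "((\<lambda>t. y + t *\<^sub>R d) \<longlongrightarrow> y + 0 *\<^sub>R d) (at_right 0)"
    by (intro tendsto_intros)
  then have "\<forall>\<^sub>F t in at_right 0. y + t *\<^sub>R d \<in> N"
    using N(1,2) by (auto dest: topological_tendstoD)
  moreover have "\<forall>\<^sub>F t in at_right 0. t < (1::real)"
    using eventually_at_right_real[of 0 "1::real"] by (auto elim: eventually_mono)
  ultimately have "\<forall>\<^sub>F t in at_right 0. 0 \<le> (Q *v y + c) \<bullet> d + t * (1/2 * (d \<bullet> (Q *v d)))"
    using eventually_at_right_less[of "0::real"]
  proof eventually_elim
    case (elim t)
    have "y + t *\<^sub>R d = (1 - t) *\<^sub>R y + t *\<^sub>R x"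
      by (simp add: d_def algebra_simps)
    also have "\<dots> \<in> qp_feasible A b"
      using elim x y by (intro convexD[OF convex_qp_feasible]) auto
    finally have "qp_objective Q c y \<le> qp_objective Q c (y + t *\<^sub>R d)"
      using N(3) elim by blast
    then have "0 \<le> t * ((Q *v y + c) \<bullet> d + t * (1/2 * (d \<bullet> (Q *v d))))"
      by (simp add: qp_objective_add[OF assms(1)] matrix_vector_mult_scaleR algebra_simps)
    then show ?case
      using elim by (simp add: zero_le_mult_iff)
  qed
  moreover have "((\<lambda>t. (Q *v y + c) \<bullet> d + t * (1/2 * (d \<bullet> (Q *v d)))) \<longlongrightarrow>
      (Q *v y + c) \<bullet> d + 0 * (1/2 * (d \<bullet> (Q *v d)))) (at_right 0)"
    by (intro tendsto_intros)
  ultimately have "0 \<le> (Q *v y + c) \<bullet> d + 0 * (1/2 * (d \<bullet> (Q *v d)))"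
    by (intro tendsto_lowerbound[where F = "at_right (0::real)"]) auto
  then show ?thesis
    by (simp add: d_def)
qed

lemma strict_imp_local_minimizer:
  assumes "strict_local_minimizer f P x"
  shows "local_minimizer f P x"
  using assms unfolding strict_local_minimizer_def local_minimizer_def
  by (metis order.refl less_imp_le)

lemma strict_imp_isolated_local_minimizer_qp:
  assumes "transpose Q = Q"
    and strict: "strict_local_minimizer (qp_objective Q c) (qp_feasible A b) x"
  shows "isolated_local_minimizer (qp_objective Q c) (qp_feasible A b) x"
proof -
  obtain r where r: "0 < r"
    "\<And>d. norm d < r \<Longrightarrow> x + d \<in> qp_feasible A b \<longleftrightarrow> d \<in> feasible_cone A b x"
    "\<And>d. norm d < r \<Longrightarrow> d \<in> feasible_cone A b x \<Longrightarrow> d \<noteq> 0 \<Longrightarrow>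
       0 < (Q *v x + c) \<bullet> d + 1/2 * (d \<bullet> (Q *v d))"
    using strict_local_minimizer_qpD[OF assms] by blast
  \<comment> \<open>Half the radius is taken so that doubling the displacement \<open>y - x\<close>
    stays within \<open>r\<close>.\<close>
  have "y = x"
    if y: "y \<in> ball x (r / 2)" "local_minimizer (qp_objective Q c) (qp_feasible A b) y" for y
  proof (rule ccontr)
    assume "y \<noteq> x"
    define d where "d = y - x"
    have d: "d \<noteq> 0" "norm d < r / 2"
      using y \<open>y \<noteq> x\<close> by (auto simp: d_def dist_norm norm_minus_commute)
    have "x + d \<in> qp_feasible A b"
      using y(2) by (simp add: d_def local_minimizer_def)
    then have "d \<in> feasible_cone A b x"
      using r(1,2) d by simp
    then have "2 *\<^sub>R d \<in> feasible_cone A b x"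
      by (rule scaleR_mem_feasible_cone) simp
    then have "0 < (Q *v x + c) \<bullet> (2 *\<^sub>R d) + 1/2 * ((2 *\<^sub>R d) \<bullet> (Q *v (2 *\<^sub>R d)))"
      using d by (intro r(3)) auto
    then have "0 < (Q *v x + c) \<bullet> d + d \<bullet> (Q *v d)"
      by (simp add: matrix_vector_mult_scaleR)
    \<comment> \<open>The slope at \<open>x + d\<close> in direction \<open>d\<close> is exactly the
      quantity just shown to be positive, while moving back towards \<open>x\<close> must not
      decrease the objective to first order.\<close>
    moreover have "0 \<le> (Q *v (x + d) + c) \<bullet> (x - (x + d))"
      using strict y(2)
      by (intro local_minimizer_qp_slope[OF assms(1)])
        (auto simp: d_def strict_local_minimizer_def)
    ultimately show False
      by (simp add: matrix_vector_right_distrib inner_add_left inner_add_right inner_commute)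
  qed
  then show ?thesis
    unfolding isolated_local_minimizer_def
    using strict_imp_local_minimizer[OF strict] r(1)
    by (intro conjI exI[of _ "ball x (r / 2)"]) auto
qed

section \<open>Finiteness by counting active sets\<close>

lemma inj_on_active_set_strict_local_minimizers:
  assumes "transpose Q = Q"
  shows "inj_on (active_set A b) {x. strict_local_minimizer (qp_objective Q c) (qp_feasible A b) x}"
proof (rule inj_onI, rule ccontr, simp only: mem_Collect_eq)
  fix x y
  assume x: "strict_local_minimizer (qp_objective Q c) (qp_feasible A b) x"
    and y: "strict_local_minimizer (qp_objective Q c) (qp_feasible A b) y"
    and eq: "active_set A b x = active_set A b y" and "x \<noteq> y"
  define d where "d = y - x"
  have d: "d \<noteq> 0" "- d \<noteq> 0"
    using \<open>x \<noteq> y\<close> by (auto simp: d_def)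
  \<comment> \<open>Both points satisfy the common active constraints with equality, so
    \<open>d\<close> and \<open>- d\<close> are feasible directions at each of them.\<close>
  have "(A *v d) $ i = 0" if "i \<in> active_set A b x" for i
    using that eq
    by (auto simp: active_set_def d_def matrix_vector_mult_diff_distrib)
  moreover have "A *v (- d) = - (A *v d)"
    using matrix_vector_mult_diff_distrib[of A 0 d] by simp
  ultimately have cone: "d \<in> feasible_cone A b z" "- d \<in> feasible_cone A b z"
    if "z \<in> {x, y}" for z
    using that eq by (auto simp: feasible_cone_def)
  have slope0: "(Q *v z + c) \<bullet> d = 0"
    if "z \<in> {x, y}" "strict_local_minimizer (qp_objective Q c) (qp_feasible A b) z" for z
    using strict_local_minimizer_qp_slope_curvature(1)[OF assms that(2) cone(1)[OF that(1)] d(1)]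
      strict_local_minimizer_qp_slope_curvature(1)[OF assms that(2) cone(2)[OF that(1)] d(2)]
    by simp
  have "0 < d \<bullet> (Q *v d)"
    using strict_local_minimizer_qp_slope_curvature(2)[OF assms x cone(1) d(1)] slope0 x by simp
  \<comment> \<open>From \<open>x\<close> to \<open>y\<close> the slope along \<open>d\<close> grows
    by the curvature, which is positive, so it cannot vanish at both ends.\<close>
  moreover have "(Q *v y + c) \<bullet> d = (Q *v x + c) \<bullet> d + d \<bullet> (Q *v d)"
    by (simp add: d_def matrix_vector_mult_diff_distrib inner_commute algebra_simps)
  ultimately show False
    using slope0 x y by simp
qed

theorem proposition12:
  fixes Q :: "real^'n^'n" and c :: "real^'n" and A :: "real^'n^'m" and b :: "real^'m"
  assumes "transpose Q = Q"
  shows "finite {x. isolated_local_minimizer (qp_objective Q c) (qp_feasible A b) x}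
    \<and> {x. isolated_local_minimizer (qp_objective Q c) (qp_feasible A b) x} =
        {x. strict_local_minimizer (qp_objective Q c) (qp_feasible A b) x}
    \<and> {x. strict_local_minimizer (qp_objective Q c) (qp_feasible A b) x} =
        {x. strong_local_minimizer (qp_objective Q c) (qp_feasible A b) x}"
proof -
  have isolated: "{x. isolated_local_minimizer (qp_objective Q c) (qp_feasible A b) x} =
      {x. strict_local_minimizer (qp_objective Q c) (qp_feasible A b) x}"
    using isolated_imp_strict_local_minimizer strict_imp_isolated_local_minimizer_qp[OF assms]
    by blast
  have strong: "{x. strict_local_minimizer (qp_objective Q c) (qp_feasible A b) x} =
      {x. strong_local_minimizer (qp_objective Q c) (qp_feasible A b) x}"
    using strong_imp_strict_local_minimizer strict_imp_strong_local_minimizer_qp[OF assms]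
    by blast
  \<comment> \<open>Active sets are subsets of the finite index type \<open>'m\<close>, so only
    finitely many occur.\<close>
  have "finite {x. strict_local_minimizer (qp_objective Q c) (qp_feasible A b) x}"
    by (rule finite_imageD[OF _ inj_on_active_set_strict_local_minimizers[OF assms]]) simp
  then show ?thesis
    using isolated strong by simp
qed

end
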